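(* Let $f:\mathbb{R}^d\to\mathbb{R}$ be a $C^2$ function for which there are constants $0<m\le M<+\infty$ with $m\le\nabla^2 f(x)\le M$ for all $x\in\mathbb{R}^d$, and let $x^*$ be the unique global minimum of $f$. Let $\gamma>0$, $\alpha>0$, $\rho>0$ and let $L>0$. Then there exist $\delta t^\star>0$, $\kappa>0$ and $C>0$ (depending on $L$, but not otherwise on the initial condition) such that, for any initial condition $(x_0,p_0,\xi_0)\in\mathbb{R}^d\times\mathbb{R}^d\times\mathbb{R}_+^d$ with $$\|x_0\|+\|p_0\|+\|\xi_0\|\le L,$$ any $\delta t\in(0,\delta t^\star)$ and any integer $n\ge 0$, the iterates of the discrete iKFAD scheme $$p_{n+1}=\beta_{n,\delta t}\,p_n-\delta t\,\nabla f(x_n),$$ $$x_{n+1}=x_n+\delta t\,\beta_{n,\delta t}\,p_n-\delta t^2\,\nabla f(x_n),$$ $$\xi_{n+1}=\mathrm{e}^{-\alpha\delta t}\Big([\xi_n]^2+\frac{(I-\mathrm{e}^{-2\Xi_n\delta t})[p_n]^2}{\rho}\Big)^{1/2}$$ satisfy $$f(x_n)-f(x^* )+\|p_n\|^2+\|\xi_n\|^2\le C\,\mathrm{e}^{-\kappa n\delta t}.$$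
   Context: Here $\Xi_n=\mathrm{diag}(\xi_n)$ is the diagonal $d\times d$ matrix with the components of $\xi_n$ on its diagonal, $I$ is the $d\times d$ identity matrix, and $\beta_{n,\delta t}=\mathrm{e}^{-(\gamma I+\Xi_n)\delta t}$ (a diagonal matrix). $[v]^2$ is the element-wise square of a vector $v$, and $(\cdot)^{1/2}$ applied to a vector is the element-wise nonnegative square root. $\|\cdot\|$ is the Euclidean norm, $\mathbb{R}_+=[0,\infty)$, and $m\le\nabla^2 f(x)\le M$ means that all eigenvalues of the Hessian of $f$ at $x$ lie in $[m,M]$. *)

theory Defs
  imports "HOL-Analysis.Analysis"
begin

definition gradient :: "(real ^ 'n \<Rightarrow> real) \<Rightarrow> real ^ 'n \<Rightarrow> real ^ 'n" where
  "gradient f x = (\<chi> i. frechet_derivative f (at x) (axis i 1))"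

lemma GDERIV_gradient:
  fixes f :: "real ^ 'n \<Rightarrow> real"
  assumes "f differentiable (at x)"
  shows "GDERIV f x :> gradient f x"
proof -
  have D: "(f has_derivative frechet_derivative f (at x)) (at x)"
    using assms frechet_derivative_works by blast
  then interpret linear "frechet_derivative f (at x)"
    by (rule has_derivative_linear)
  have "frechet_derivative f (at x) h = h \<bullet> gradient f x" for h
  proof -
    have "frechet_derivative f (at x) h
        = frechet_derivative f (at x) (\<Sum>i\<in>UNIV. h $ i *\<^sub>R axis i 1)"
      by (simp add: basis_expansion flip: scalar_mult_eq_scaleR)
    also have "\<dots> = h \<bullet> gradient f x"
      by (simp add: sum scaleR inner_vec_def gradient_def)
    finally show ?thesis .
  qed
  then have "frechet_derivative f (at x) = (\<lambda>h. h \<bullet> gradient f x)"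
    by blast
  with D show ?thesis
    by (simp add: gderiv_def)
qed

definition hessian :: "(real ^ 'n \<Rightarrow> real) \<Rightarrow> real ^ 'n \<Rightarrow> real ^ 'n ^ 'n" where
  "hessian f x = jacobian (gradient f) (at x)"

definition C2 :: "(real ^ 'n \<Rightarrow> real) \<Rightarrow> bool" where
  "C2 f \<longleftrightarrow> (\<forall>x. f differentiable (at x)) \<and> (\<forall>x. gradient f differentiable (at x))
     \<and> continuous_on UNIV (hessian f)"

text \<open>Real eigenvalues only; the Hessian of a \<open>C2\<close> function is symmetric, so it has no others.\<close>

definition eigenvalue :: "real ^ 'n ^ 'n \<Rightarrow> real \<Rightarrow> bool" where
  "eigenvalue A \<mu> \<longleftrightarrow> (\<exists>v. v \<noteq> 0 \<and> A *v v = \<mu> *\<^sub>R v)"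

definition diag :: "real ^ 'n \<Rightarrow> real ^ 'n ^ 'n" where
  "diag v = (\<chi> i j. if i = j then v $ i else 0)"

text \<open>
  The power and multiplication of the type \<open>real ^ 'n ^ 'n\<close> are componentwise and the type is not
  a Banach algebra instance, so the library's \<open>exp\<close> does not apply to matrices.
\<close>

definition mat_exp :: "real ^ 'n ^ 'n \<Rightarrow> real ^ 'n ^ 'n" where
  "mat_exp A = (\<Sum>k. (1 / fact k) *\<^sub>R (((**) A ^^ k) (mat 1)))"

lemma diag_power: "((**) (diag v) ^^ k) (mat 1) = diag (\<chi> i. v $ i ^ k)"
proof (induction k)
  case 0
  show ?case
    by (simp add: diag_def mat_def vec_eq_iff)
next
  case (Suc k)
  then show ?case
    by (simp add: diag_def matrix_matrix_mult_def vec_eq_iff if_distrib if_distribR cong: if_cong)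
qed

lemma mat_exp_diag: "mat_exp (diag v) = diag (\<chi> i. exp (v $ i))"
proof -
  have "(\<lambda>k. (1 / fact k) *\<^sub>R diag (\<chi> i. v $ i ^ k)) sums diag (\<chi> i. exp (v $ i))"
    unfolding sums_def
  proof (intro vec_tendstoI)
    fix i j
    have "(\<lambda>k. v $ i ^ k / fact k) sums exp (v $ i)"
      using exp_converges[of "v $ i"] by (simp add: divide_inverse_commute)
    then show "(\<lambda>n. (\<Sum>k<n. (1 / fact k) *\<^sub>R diag (\<chi> i. v $ i ^ k)) $ i $ j)
        \<longlonglongrightarrow> diag (\<chi> i. exp (v $ i)) $ i $ j"
      by (cases "i = j") (simp_all add: sums_def diag_def)
  qed
  then show ?thesis
    unfolding mat_exp_def diag_power by (rule sums_unique[symmetric])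
qed

definition vec_square :: "real ^ 'n \<Rightarrow> real ^ 'n" where
  "vec_square v = (\<chi> i. (v $ i)\<^sup>2)"

definition vec_sqrt :: "real ^ 'n \<Rightarrow> real ^ 'n" where
  "vec_sqrt v = (\<chi> i. sqrt (v $ i))"

definition ikfad_beta :: "real \<Rightarrow> real \<Rightarrow> real ^ 'n \<Rightarrow> real ^ 'n ^ 'n" where
  "ikfad_beta \<gamma> \<delta>t \<xi> = mat_exp (- \<delta>t *\<^sub>R (\<gamma> *\<^sub>R mat 1 + diag \<xi>))"

definition ikfad_iterates ::
  "(real ^ 'n \<Rightarrow> real) \<Rightarrow> real \<Rightarrow> real \<Rightarrow> real \<Rightarrow> real \<Rightarrow>
   (nat \<Rightarrow> real ^ 'n) \<Rightarrow> (nat \<Rightarrow> real ^ 'n) \<Rightarrow> (nat \<Rightarrow> real ^ 'n) \<Rightarrow> bool" where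
  "ikfad_iterates f \<gamma> \<alpha> \<rho> \<delta>t x p \<xi> \<longleftrightarrow> (\<forall>n.
     p (Suc n) = ikfad_beta \<gamma> \<delta>t (\<xi> n) *v p n - \<delta>t *\<^sub>R gradient f (x n) \<and>
     x (Suc n) = x n + \<delta>t *\<^sub>R (ikfad_beta \<gamma> \<delta>t (\<xi> n) *v p n) - \<delta>t\<^sup>2 *\<^sub>R gradient f (x n) \<and>
     \<xi> (Suc n) = exp (- \<alpha> * \<delta>t) *\<^sub>R vec_sqrt (vec_square (\<xi> n)
       + (1 / \<rho>) *\<^sub>R ((mat 1 - mat_exp (- (2 * \<delta>t) *\<^sub>R diag (\<xi> n))) *v vec_square (p n))))"

end

theory Submission
  imports Defs
begin

text \<open>
  The total energy \<open>T = f x - f x\<^sup>* + \<bar>p\<bar>\<^sup>2 / 2 + \<rho> \<bar>\<xi>\<bar>\<^sup>2 / 2\<close> does not increase for small steps, because the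
  discretisation error of order \<open>h\<^sup>2 \<bar>p\<bar>\<^sup>2\<close> is absorbed by the linear friction and the energy that
  \<open>p\<close> loses to \<open>\<xi>\<close> is balanced by the update of \<open>\<xi>\<close>. Hence \<open>\<xi>\<close> stays bounded in terms of \<open>L\<close>, and
  so does the total friction coefficient. Moreover the \<open>p\<close> and \<open>\<xi>\<close> parts of \<open>T\<close> are dissipated. Adding a small
  multiple of \<open>p \<bullet> (x - x\<^sup>*)\<close> also yields dissipation of \<open>f x - f x\<^sup>*\<close> by strong convexity; here the
  bound on the friction enters. The modified energy is comparable to \<open>T\<close> and contracts by a factor
  \<open>exp (- \<kappa> h)\<close> in each step. The quadratic bounds on \<open>f\<close> come from Taylor's formula, where the
  eigenvalue bounds control the quadratic form of the Hessian because the latter is symmetric.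
\<close>

section \<open>Symmetry of the Hessian and quadratic bounds on \<open>f\<close>\<close>

text \<open>The mean value theorem in direction \<open>u\<close> turns the second difference into
  \<open>s\<close> times a difference of two gradients paired with \<open>u\<close>; both gradients
  are then linearised at \<open>x\<close>.\<close>

lemma second_difference_approx:
  fixes f :: "'a::real_inner \<Rightarrow> real"
  assumes f: "\<And>x. GDERIV f x :> g x"
    and g: "(g has_derivative H) (at x)"
    and e: "e > 0"
  shows "\<exists>d>0. \<forall>s. 0 < s \<longrightarrow> s < d \<longrightarrow>
    \<bar>(f (x + s *\<^sub>R u + s *\<^sub>R v) - f (x + s *\<^sub>R u) - f (x + s *\<^sub>R v) + f x) - s\<^sup>2 * (u \<bullet> H v)\<bar> \<le> e * s\<^sup>2"
proof -
  interpret H: linear H using g by (rule has_derivative_linear)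
  define K where "K = 1 + norm u + norm v"
  have K: "K \<ge> 1" "K > 0" "norm u \<le> K" by (simp_all add: K_def add_pos_nonneg)
  \<comment> \<open>Two remainders of size \<open>e' * (s * K)\<close>, each paired with
    \<open>u\<close> of norm at most \<open>K\<close>, add up to \<open>e * s\<close>.\<close>
  define e' where "e' = e / (2 * K\<^sup>2)"
  have e': "e' > 0" using e K by (simp add: e'_def)
  obtain d where d: "d > 0" and
    dd: "\<And>y. norm (y - x) < d \<Longrightarrow> norm (g y - g x - H (y - x)) \<le> e' * norm (y - x)"
    using g e' unfolding has_derivative_at_alt by blast
  have *: "\<bar>(f (x + s *\<^sub>R u + s *\<^sub>R v) - f (x + s *\<^sub>R u) - f (x + s *\<^sub>R v) + f x) - s\<^sup>2 * (u \<bullet> H v)\<bar> \<le> e * s\<^sup>2"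
    if s: "0 < s" "s < d / K" for s
  proof -
    have sK: "s * K < d" using s K by (simp add: field_simps)
    let ?\<psi> = "\<lambda>t. f (x + t *\<^sub>R u + s *\<^sub>R v) - f (x + t *\<^sub>R u)"
    have D: "((\<lambda>t. f (z + t *\<^sub>R u)) has_real_derivative u \<bullet> g (z + t *\<^sub>R u)) (at t)" for z t
    proof -
      have "((\<lambda>t. f (z + t *\<^sub>R u)) has_derivative (\<lambda>h. (h *\<^sub>R u) \<bullet> g (z + t *\<^sub>R u))) (at t)"
        by (rule has_derivative_compose[of "\<lambda>t. z + t *\<^sub>R u"])
          (use f in \<open>auto intro!: derivative_eq_intros simp: gderiv_def\<close>)
      moreover have "(\<lambda>h. (h *\<^sub>R u) \<bullet> g (z + t *\<^sub>R u)) = (*) (u \<bullet> g (z + t *\<^sub>R u))"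
        by (simp add: fun_eq_iff)
      ultimately show ?thesis by (simp add: has_field_derivative_def)
    qed
    have "DERIV ?\<psi> t :> u \<bullet> g (x + t *\<^sub>R u + s *\<^sub>R v) - u \<bullet> g (x + t *\<^sub>R u)" for t
      using DERIV_diff[OF D[of "x + s *\<^sub>R v" t] D[of x t]] by (simp add: algebra_simps)
    then obtain t where t: "0 < t" "t < s" and
      eq: "?\<psi> s - ?\<psi> 0 = (s - 0) * (u \<bullet> g (x + t *\<^sub>R u + s *\<^sub>R v) - u \<bullet> g (x + t *\<^sub>R u))"
      using MVT2[OF s(1), of ?\<psi> "\<lambda>t. u \<bullet> g (x + t *\<^sub>R u + s *\<^sub>R v) - u \<bullet> g (x + t *\<^sub>R u)"] by blast
    define a where "a = g (x + (t *\<^sub>R u + s *\<^sub>R v)) - g x - H (t *\<^sub>R u + s *\<^sub>R v)"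
    define b where "b = g (x + t *\<^sub>R u) - g x - H (t *\<^sub>R u)"
    have n1: "norm (t *\<^sub>R u + s *\<^sub>R v) \<le> s * K"
    proof -
      have "norm (t *\<^sub>R u + s *\<^sub>R v) \<le> t * norm u + s * norm v"
        using t s by (intro norm_triangle_le) simp
      also have "\<dots> \<le> s * norm u + s * norm v"
        using t by (intro add_mono mult_right_mono) auto
      also have "\<dots> \<le> s * K" using s by (simp add: K_def algebra_simps)
      finally show ?thesis .
    qed
    have n2: "norm (t *\<^sub>R u) \<le> s * K"
    proof -
      have "norm (t *\<^sub>R u) = t * norm u" using t by simp
      also have "\<dots> \<le> s * K" using t s K by (intro mult_mono) auto
      finally show ?thesis .
    qed
    have "norm a \<le> e' * norm (t *\<^sub>R u + s *\<^sub>R v)"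
      using dd[of "x + (t *\<^sub>R u + s *\<^sub>R v)"] n1 sK by (simp add: a_def)
    also have "\<dots> \<le> e' * (s * K)" using n1 e' by (intro mult_left_mono) auto
    finally have a: "norm a \<le> e' * (s * K)" .
    have "norm b \<le> e' * norm (t *\<^sub>R u)"
      using dd[of "x + t *\<^sub>R u"] n2 sK by (simp add: b_def)
    also have "\<dots> \<le> e' * (s * K)" using n2 e' by (intro mult_left_mono) auto
    finally have b: "norm b \<le> e' * (s * K)" .
    \<comment> \<open>The two linear parts differ by \<open>s *\<^sub>R H v\<close>, so the
      intermediate point \<open>t\<close> drops out and only remainders are left.\<close>
    have "(f (x + s *\<^sub>R u + s *\<^sub>R v) - f (x + s *\<^sub>R u) - f (x + s *\<^sub>R v) + f x) - s\<^sup>2 * (u \<bullet> H v)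
        = s * (u \<bullet> (a - b))"
      using eq by (simp add: a_def b_def H.add H.scaleR inner_simps algebra_simps power2_eq_square)
    moreover have "\<bar>u \<bullet> (a - b)\<bar> \<le> K * (2 * (e' * (s * K)))"
    proof -
      have "\<bar>u \<bullet> (a - b)\<bar> \<le> norm u * norm (a - b)" by (rule Cauchy_Schwarz_ineq2)
      also have "\<dots> \<le> K * (norm a + norm b)"
        using K by (intro mult_mono norm_triangle_ineq4) auto
      also have "\<dots> \<le> K * (2 * (e' * (s * K)))"
        using a b K by (intro mult_left_mono) auto
      finally show ?thesis .
    qed
    moreover have "s * (K * (2 * (e' * (s * K)))) = e * s\<^sup>2"
      using K by (simp add: e'_def power2_eq_square)
    ultimately show ?thesis using s
      by (metis abs_mult abs_of_pos mult_le_cancel_left_pos)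
  qed
  show ?thesis
    by (rule exI[of _ "d / K"]) (use * d K in auto)
qed

text \<open>Exchanging \<open>u\<close> and \<open>v\<close> leaves the second difference unchanged,
  so after division by \<open>s\<^sup>2\<close> both inner products approximate the same
  number.\<close>

lemma derivative_of_gradient_symmetric:
  fixes f :: "'a::real_inner \<Rightarrow> real"
  assumes f: "\<And>x. GDERIV f x :> g x"
    and g: "(g has_derivative H) (at x)"
  shows "u \<bullet> H v = v \<bullet> H u"
proof -
  have "\<bar>u \<bullet> H v - v \<bullet> H u\<bar> \<le> 0 + e" if e: "e > 0" for e
  proof -
    obtain d1 where d1: "d1 > 0" "\<And>s. 0 < s \<Longrightarrow> s < d1 \<Longrightarrow>
      \<bar>(f (x + s *\<^sub>R u + s *\<^sub>R v) - f (x + s *\<^sub>R u) - f (x + s *\<^sub>R v) + f x) - s\<^sup>2 * (u \<bullet> H v)\<bar> \<le> e/2 * s\<^sup>2"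
      using second_difference_approx[OF f g, of "e/2" u v] e by auto
    obtain d2 where d2: "d2 > 0" "\<And>s. 0 < s \<Longrightarrow> s < d2 \<Longrightarrow>
      \<bar>(f (x + s *\<^sub>R v + s *\<^sub>R u) - f (x + s *\<^sub>R v) - f (x + s *\<^sub>R u) + f x) - s\<^sup>2 * (v \<bullet> H u)\<bar> \<le> e/2 * s\<^sup>2"
      using second_difference_approx[OF f g, of "e/2" v u] e by auto
    define s where "s = min d1 d2 / 2"
    have s: "0 < s" "s < d1" "s < d2" using d1 d2 by (auto simp: s_def)
    have comm: "x + s *\<^sub>R v + s *\<^sub>R u = x + s *\<^sub>R u + s *\<^sub>R v" by (simp add: algebra_simps)
    have "\<bar>s\<^sup>2 * (u \<bullet> H v) - s\<^sup>2 * (v \<bullet> H u)\<bar> \<le> e * s\<^sup>2"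
      using d1(2)[OF s(1,2)] d2(2)[OF s(1,3), unfolded comm] by (simp only: abs_le_iff) linarith
    moreover have "\<bar>s\<^sup>2 * (u \<bullet> H v) - s\<^sup>2 * (v \<bullet> H u)\<bar> = s\<^sup>2 * \<bar>u \<bullet> H v - v \<bullet> H u\<bar>"
      by (simp add: abs_mult flip: right_diff_distrib)
    ultimately have "s\<^sup>2 * \<bar>u \<bullet> H v - v \<bullet> H u\<bar> \<le> s\<^sup>2 * e"
      by (simp only: mult.commute)
    then show ?thesis using s by simp
  qed
  then have "\<bar>u \<bullet> H v - v \<bullet> H u\<bar> \<le> 0" by (rule field_le_epsilon)
  then show ?thesis by simp
qed

text \<open>A minimiser \<open>w\<close> of the quadratic form on the unit sphere is an eigenvector:
  if the residual \<open>r\<close> were nonzero, moving from \<open>w\<close> along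
  \<open>- r\<close> would push the form below \<open>\<mu>\<close> times the squared norm.\<close>

lemma symmetric_linear_least_eigenvalue:
  fixes T :: "'a::euclidean_space \<Rightarrow> 'a"
  assumes T: "linear T" and sym: "\<And>u v. u \<bullet> T v = v \<bullet> T u"
  obtains \<mu> w where "w \<noteq> 0" "T w = \<mu> *\<^sub>R w" "\<And>v. \<mu> * (norm v)\<^sup>2 \<le> v \<bullet> T v"
proof -
  interpret T: linear T by (rule T)
  have ne: "sphere (0::'a) 1 \<noteq> {}" by simp
  have "continuous_on (sphere 0 1) (\<lambda>v. v \<bullet> T v)"
    by (intro continuous_intros linear_continuous_on T[unfolded linear_conv_bounded_linear])
  then obtain w where w: "norm w = 1" and wmin: "\<And>v. norm v = 1 \<Longrightarrow> w \<bullet> T w \<le> v \<bullet> T v"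
    using continuous_attains_inf[OF compact_sphere ne] by (metis mem_sphere_0)
  define \<mu> where "\<mu> = w \<bullet> T w"
  have min: "\<mu> * (norm v)\<^sup>2 \<le> v \<bullet> T v" for v
  proof (cases "v = 0")
    case False
    then have "\<mu> \<le> (v /\<^sub>R norm v) \<bullet> T (v /\<^sub>R norm v)" unfolding \<mu>_def by (intro wmin) simp
    then show ?thesis using False by (simp add: T.scaleR field_simps power2_eq_square)
  qed (simp add: T.zero)
  define r where "r = T w - \<mu> *\<^sub>R w"
  define q where "q = r \<bullet> T r - \<mu> * (norm r)\<^sup>2"
  have q: "q \<ge> 0" using min[of r] by (simp add: q_def)
  \<comment> \<open>For \<open>q > 0\<close> the parabola
    \<open>2 * t * (norm r)\<^sup>2 + t\<^sup>2 * q\<close> is least at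
    \<open>- (norm r)\<^sup>2 / q\<close>; the added 1 covers \<open>q = 0\<close> and still makes
    the value negative unless \<open>r = 0\<close>.\<close>
  define t where "t = - (norm r)\<^sup>2 / (q + 1)"
  have "\<mu> * (norm (w + t *\<^sub>R r))\<^sup>2 \<le> (w + t *\<^sub>R r) \<bullet> T (w + t *\<^sub>R r)" by (rule min)
  moreover have "(w + t *\<^sub>R r) \<bullet> T (w + t *\<^sub>R r) - \<mu> * (norm (w + t *\<^sub>R r))\<^sup>2
      = 2 * t * (norm r)\<^sup>2 + t\<^sup>2 * q"
  proof -
    have "(norm (w + t *\<^sub>R r))\<^sup>2 = 1 + 2 * t * (w \<bullet> r) + t\<^sup>2 * (norm r)\<^sup>2"
      using w unfolding power2_norm_eq_inner
      by (simp add: inner_simps norm_eq_1 inner_commute power2_eq_square algebra_simps)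
    moreover have "(w + t *\<^sub>R r) \<bullet> T (w + t *\<^sub>R r) = \<mu> + 2 * t * (r \<bullet> T w) + t\<^sup>2 * (r \<bullet> T r)"
      using sym[of w r]
      by (simp add: inner_simps T.add T.scaleR \<mu>_def power2_eq_square algebra_simps)
    moreover have "r \<bullet> T w = (norm r)\<^sup>2 + \<mu> * (w \<bullet> r)"
      by (simp add: r_def power2_norm_eq_inner inner_simps inner_commute algebra_simps)
    ultimately show ?thesis by (simp add: q_def algebra_simps)
  qed
  ultimately have "0 \<le> 2 * t * (norm r)\<^sup>2 + t\<^sup>2 * q" by linarith
  moreover have tq: "(norm r)\<^sup>2 = - t * (q + 1)" using q by (simp add: t_def)
  moreover have "2 * t * (- t * (q + 1)) + t\<^sup>2 * q = - (t\<^sup>2 * (q + 2))"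
    by (simp add: power2_eq_square algebra_simps)
  ultimately have "0 \<le> - (t\<^sup>2 * (q + 2))" by simp
  then have "t = 0" using q by (auto simp: mult_le_0_iff)
  then have "r = 0" using tq by simp
  then have "T w = \<mu> *\<^sub>R w" by (simp add: r_def)
  moreover have "w \<noteq> 0" using w by auto
  ultimately show thesis using that min by blast
qed

text \<open>Maclaurin's formula of order 2 for the restriction of \<open>f\<close> to the segment
  from \<open>x\<close> to \<open>x + v\<close>; \<open>df\<close> lists the successive derivatives
  of this restriction.\<close>

lemma taylor_quadratic:
  fixes f :: "'a::real_inner \<Rightarrow> real"
  assumes f: "\<And>x. GDERIV f x :> g x"
    and g: "\<And>x. (g has_derivative H x) (at x)"
  shows "\<exists>z. f (x + v) = f x + v \<bullet> g x + (v \<bullet> H z v) / 2"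
proof -
  define df :: "nat \<Rightarrow> real \<Rightarrow> real" where "df = (\<lambda>n t. if n = 0 then f (x + t *\<^sub>R v)
    else if n = 1 then v \<bullet> g (x + t *\<^sub>R v) else v \<bullet> H (x + t *\<^sub>R v) v)"
  have D: "DERIV (df k) t :> df (Suc k) t" if "k < 2" for k t
  proof -
    have l: "((\<lambda>t. x + t *\<^sub>R v) has_derivative (\<lambda>h. h *\<^sub>R v)) (at t)"
      by (auto intro!: derivative_eq_intros)
    have "((\<lambda>t. f (x + t *\<^sub>R v)) has_derivative (\<lambda>h. (h *\<^sub>R v) \<bullet> g (x + t *\<^sub>R v))) (at t)"
      using f by (intro has_derivative_compose[OF l]) (simp add: gderiv_def)
    moreover have "(\<lambda>h. (h *\<^sub>R v) \<bullet> g (x + t *\<^sub>R v)) = (*) (v \<bullet> g (x + t *\<^sub>R v))"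
      by (simp add: fun_eq_iff)
    ultimately have 0: "DERIV (\<lambda>t. f (x + t *\<^sub>R v)) t :> v \<bullet> g (x + t *\<^sub>R v)"
      by (simp add: has_field_derivative_def)
    have "((\<lambda>t. v \<bullet> g (x + t *\<^sub>R v)) has_derivative (\<lambda>h. v \<bullet> H (x + t *\<^sub>R v) (h *\<^sub>R v))) (at t)"
      by (intro has_derivative_inner_right has_derivative_compose[OF l] g)
    moreover have "(\<lambda>h. v \<bullet> H (x + t *\<^sub>R v) (h *\<^sub>R v)) = (*) (v \<bullet> H (x + t *\<^sub>R v) v)"
      by (simp add: fun_eq_iff linear_scale[OF has_derivative_linear[OF g]])
    ultimately have 1: "DERIV (\<lambda>t. v \<bullet> g (x + t *\<^sub>R v)) t :> v \<bullet> H (x + t *\<^sub>R v) v"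
      by (simp add: has_field_derivative_def)
    show ?thesis using that 0 1 by (auto simp: df_def less_2_cases_iff)
  qed
  obtain t where "0 < t" "t < 1" "df 0 1 = (\<Sum>k<2. df k 0 / fact k * 1 ^ k) + df 2 t / fact 2 * 1 ^ 2"
    using Maclaurin[of 1 2 df "df 0"] D by auto
  then show ?thesis by (auto simp: df_def numeral_2_eq_2)
qed

lemma hessian_quadratic_bounds:
  fixes f :: "real ^ 'n \<Rightarrow> real"
  assumes C2: "C2 f"
    and ev: "\<And>x \<mu>. eigenvalue (hessian f x) \<mu> \<Longrightarrow> m \<le> \<mu> \<and> \<mu> \<le> M"
  shows "f x + (y - x) \<bullet> gradient f x + m / 2 * (norm (y - x))\<^sup>2 \<le> f y"
    and "f y \<le> f x + (y - x) \<bullet> gradient f x + M / 2 * (norm (y - x))\<^sup>2"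
proof -
  have f: "GDERIV f z :> gradient f z" for z
    using C2 by (simp add: C2_def GDERIV_gradient)
  have g: "(gradient f has_derivative (*v) (hessian f z)) (at z)" for z
    using C2 jacobian_works by (force simp: C2_def hessian_def)
  note sym = derivative_of_gradient_symmetric[OF f g]
  obtain z where z: "f y = f x + (y - x) \<bullet> gradient f x + ((y - x) \<bullet> (hessian f z *v (y - x))) / 2"
    using taylor_quadratic[OF f g, of x "y - x"] by auto
  obtain \<mu> w where 1: "w \<noteq> 0" "hessian f z *v w = \<mu> *\<^sub>R w"
    "\<And>v. \<mu> * (norm v)\<^sup>2 \<le> v \<bullet> (hessian f z *v v)"
    using symmetric_linear_least_eigenvalue[OF has_derivative_linear[OF g[of z]] sym[of _ z]] by blast
  have "m \<le> \<mu>" using ev[of z \<mu>] 1(1,2) unfolding eigenvalue_def by blast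
  then have "m * (norm (y - x))\<^sup>2 \<le> (y - x) \<bullet> (hessian f z *v (y - x))"
    using 1(3) by (meson mult_right_mono order_trans zero_le_power2)
  with z show "f x + (y - x) \<bullet> gradient f x + m / 2 * (norm (y - x))\<^sup>2 \<le> f y" by simp
  \<comment> \<open>The least eigenvalue of the negated Hessian is minus an eigenvalue of the
    Hessian, which gives the upper bound.\<close>
  obtain \<nu> u where 2: "u \<noteq> 0" "- (hessian f z *v u) = \<nu> *\<^sub>R u"
    "\<And>v. \<nu> * (norm v)\<^sup>2 \<le> v \<bullet> - (hessian f z *v v)"
  proof (rule symmetric_linear_least_eigenvalue)
    show "linear (\<lambda>v. - (hessian f z *v v))"
      by (intro linear_compose_neg has_derivative_linear[OF g])
  qed (use sym in auto)
  have "hessian f z *v u = (- \<nu>) *\<^sub>R u" using 2(2) by (metis add.inverse_inverse scaleR_minus_left)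
  then have "- \<nu> \<le> M" using ev[of z "- \<nu>"] 2(1) unfolding eigenvalue_def by blast
  then have "(- \<nu>) * (norm (y - x))\<^sup>2 \<le> M * (norm (y - x))\<^sup>2" by (intro mult_right_mono) auto
  then have "(y - x) \<bullet> (hessian f z *v (y - x)) \<le> M * (norm (y - x))\<^sup>2"
    using 2(3)[of "y - x"] by simp
  with z show "f y \<le> f x + (y - x) \<bullet> gradient f x + M / 2 * (norm (y - x))\<^sup>2" by simp
qed

section \<open>Componentwise form of the damping and an estimate of the exponential\<close>

lemma diag_vector_mult: "(diag v *v w) $ i = v $ i * w $ i"
  by (simp add: diag_def matrix_vector_mult_def if_distrib if_distribR cong: if_cong)

lemma ikfad_beta_vector_mult:
  "(ikfad_beta \<gamma> h \<xi> *v p) $ i = exp (- (\<gamma> + \<xi> $ i) * h) * p $ i"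
proof -
  have "- h *\<^sub>R (\<gamma> *\<^sub>R mat 1 + diag \<xi>) = diag (\<chi> i. - (\<gamma> + \<xi> $ i) * h)"
    by (simp add: vec_eq_iff diag_def mat_def algebra_simps)
  then show ?thesis
    by (simp add: ikfad_beta_def mat_exp_diag diag_vector_mult)
qed

lemma norm_vec_squared: "(norm v)\<^sup>2 = (\<Sum>i\<in>UNIV. (v $ i)\<^sup>2)" for v :: "real ^ 'n"
  unfolding power2_norm_eq_inner inner_vec_def by (simp add: power2_eq_square)

text \<open>Turns a contraction factor into a loss linear in the step size, to be weighed against
  the other terms of order \<open>h\<close>.\<close>

lemma exp_minus_le_linear: "exp (- x) \<le> 1 - x / 2" if "0 \<le> x" "x \<le> 1" for x :: real
proof -
  have "x * x \<le> x * 1" using that by (intro mult_left_mono) auto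
  then have "1 \<le> (1 - x / 2) * (1 + x)" by (simp add: algebra_simps)
  also have "\<dots> \<le> (1 - x / 2) * exp x"
    using that by (intro mult_left_mono exp_ge_add_one_self) auto
  finally show ?thesis by (simp add: exp_minus field_simps)
qed

section \<open>One-step estimates for smooth strongly convex functions\<close>

text \<open>The eigenvalue bounds on the Hessian enter all that follows only through
  \<open>lower\<close> and \<open>upper\<close>.\<close>

locale smooth_strongly_convex =
  fixes f :: "'a::real_inner \<Rightarrow> real" and g :: "'a \<Rightarrow> 'a" and m M :: real and xstar :: 'a
  assumes lower: "f x + (y - x) \<bullet> g x + m / 2 * (norm (y - x))\<^sup>2 \<le> f y"
    and upper: "f y \<le> f x + (y - x) \<bullet> g x + M / 2 * (norm (y - x))\<^sup>2"
    and minimum: "f xstar \<le> f y"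
    and m_pos: "0 < m" and m_le_M: "m \<le> M"
begin

lemma M_pos: "0 < M"
  using m_pos m_le_M by simp

text \<open>A gradient step of length \<open>1 / M\<close> lowers \<open>f\<close> by at least
  \<open>(norm (g x))\<^sup>2 / (2 * M)\<close> and cannot go below the minimum.\<close>

lemma gradient_norm_le: "(norm (g x))\<^sup>2 \<le> 2 * M * (f x - f xstar)"
proof -
  have "f xstar \<le> f (x - (1 / M) *\<^sub>R g x)" by (rule minimum)
  also have "\<dots> \<le> f x - (norm (g x))\<^sup>2 / (2 * M)"
    using upper[of "x - (1 / M) *\<^sub>R g x" x] M_pos
    by (simp add: power_divide power2_norm_eq_inner[symmetric] field_simps power2_eq_square)
  finally show ?thesis using M_pos by (simp add: field_simps)
qed

lemma gradient_minimum: "g xstar = 0"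
  using gradient_norm_le[of xstar] by simp

lemma quadratic_growth: "m / 2 * (norm (x - xstar))\<^sup>2 \<le> f x - f xstar"
  using lower[of xstar x] by (simp add: gradient_minimum)

lemma quadratic_upper: "f x - f xstar \<le> M / 2 * (norm (x - xstar))\<^sup>2"
  using upper[of x xstar] by (simp add: gradient_minimum)

text \<open>In the cross term, the value gap is the dissipation sought, while the squared distance
  absorbs the work of the friction.\<close>

lemma gradient_coercive: "f x - f xstar + m / 2 * (norm (x - xstar))\<^sup>2 \<le> g x \<bullet> (x - xstar)"
  using lower[of x xstar] by (simp add: norm_minus_commute inner_commute inner_diff_right)

text \<open>As \<open>x\<close> moves with the updated momentum \<open>p'\<close>, the first-order
  change of \<open>f\<close> cancels against the change of kinetic energy in the kick from
  \<open>q\<close> to \<open>p'\<close>. Only the curvature error of order \<open>h\<^sup>2\<close>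
  remains.\<close>

lemma mechanical_energy_step:
  assumes h: "0 < h" and Mh: "2 * M * h\<^sup>2 \<le> 1"
    and p': "p' = q - h *\<^sub>R g x" and x': "x' = x + h *\<^sub>R p'"
  shows "f x' + (norm p')\<^sup>2 / 2 \<le> f x + (1 + 2 * M * h\<^sup>2) * (norm q)\<^sup>2 / 2"
proof -
  define c where "c = M * h\<^sup>2"
  define G where "G = h\<^sup>2 * (norm (g x))\<^sup>2"
  have "f x' \<le> f x + h * (p' \<bullet> g x) + c * (norm p')\<^sup>2 / 2"
    using upper[of x' x] h by (simp add: x' c_def power_mult_distrib)
  moreover have "(norm q)\<^sup>2 = (norm p')\<^sup>2 + 2 * (h * (p' \<bullet> g x)) + G"
  proof -
    have q: "q = p' + h *\<^sub>R g x" by (simp add: p')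
    show ?thesis unfolding q G_def power2_norm_eq_inner
      by (simp add: inner_simps inner_commute algebra_simps power2_eq_square)
  qed
  moreover have "(norm p')\<^sup>2 \<le> 2 * (norm q)\<^sup>2 + 2 * G"
  proof -
    have "0 \<le> (norm (q + h *\<^sub>R g x))\<^sup>2" by simp
    then show ?thesis unfolding p' G_def power2_norm_eq_inner
      by (simp add: inner_simps inner_commute algebra_simps power2_eq_square)
  qed
  then have "c * (norm p')\<^sup>2 \<le> c * (2 * (norm q)\<^sup>2 + 2 * G)"
    using M_pos by (intro mult_left_mono) (auto simp: c_def)
  moreover have "c * (2 * (norm q)\<^sup>2 + 2 * G) = 2 * (c * (norm q)\<^sup>2) + 2 * (c * G)"
    by (simp add: algebra_simps)
  \<comment> \<open>The gradient part of the curvature error is covered by the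
    \<open>- G / 2\<close> left over from the kick.\<close>
  moreover have "2 * (c * G) \<le> G"
    using mult_right_mono[OF Mh, of G] by (simp add: c_def G_def mult.assoc)
  moreover have "(1 + 2 * M * h\<^sup>2) * (norm q)\<^sup>2 = (norm q)\<^sup>2 + 2 * (c * (norm q)\<^sup>2)"
    by (simp add: c_def algebra_simps)
  ultimately show ?thesis by linarith
qed

text \<open>Here \<open>q\<close> is the damped momentum and \<open>K\<close> bounds the friction
  coefficient. Of the value gap supplied by coercivity, half pays for the gradient contained in
  \<open>(norm p')\<^sup>2\<close>; the other half is the gain.\<close>

lemma cross_term_step:
  assumes h: "0 < h" and Mh: "8 * M * h\<^sup>2 \<le> 1"
    and p': "p' = q - h *\<^sub>R g x" and x': "x' = x + h *\<^sub>R p'"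
    and q: "norm q \<le> norm p" and pq: "norm (p - q) \<le> K * h * norm p"
  shows "p' \<bullet> (x' - xstar) \<le> p \<bullet> (x - xstar)
    + h * ((2 + K\<^sup>2 / (2 * m)) * (norm p)\<^sup>2 - (f x - f xstar) / 2)"
proof -
  define y where "y = x - xstar"
  define F where "F = f x - f xstar"
  have F: "0 \<le> F" using minimum by (simp add: F_def)
  have "p' \<bullet> (x' - xstar) = p \<bullet> y + h * (norm p')\<^sup>2 - (p - q) \<bullet> y - h * (g x \<bullet> y)"
    unfolding x' p' y_def power2_norm_eq_inner by (simp add: inner_simps algebra_simps)
  moreover have "(norm p')\<^sup>2 \<le> 2 * (norm p)\<^sup>2 + F / 2"
  proof -
    have "0 \<le> (norm (q + h *\<^sub>R g x))\<^sup>2" by simp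
    then have "(norm p')\<^sup>2 \<le> 2 * (norm q)\<^sup>2 + 2 * (h\<^sup>2 * (norm (g x))\<^sup>2)"
      unfolding p' power2_norm_eq_inner
      by (simp add: inner_simps inner_commute algebra_simps power2_eq_square)
    moreover have "(norm q)\<^sup>2 \<le> (norm p)\<^sup>2" using q by (simp add: power_mono)
    moreover have "h\<^sup>2 * (norm (g x))\<^sup>2 \<le> h\<^sup>2 * (2 * M * F)"
      unfolding F_def by (intro mult_left_mono gradient_norm_le) auto
    moreover have "4 * (h\<^sup>2 * (2 * M * F)) \<le> F"
      using mult_right_mono[OF Mh F] by (simp add: algebra_simps)
    ultimately show ?thesis by linarith
  qed
  then have "h * (norm p')\<^sup>2 \<le> h * (2 * (norm p)\<^sup>2 + F / 2)"
    using h by (intro mult_left_mono) auto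
  moreover have "- ((p - q) \<bullet> y) \<le> h * (m / 2 * (norm y)\<^sup>2 + K\<^sup>2 / (2 * m) * (norm p)\<^sup>2)"
  proof -
    have "- ((p - q) \<bullet> y) \<le> norm (p - q) * norm y"
      using Cauchy_Schwarz_ineq2[of "p - q" y] by linarith
    also have "\<dots> \<le> K * h * norm p * norm y" by (intro mult_right_mono pq) auto
    also have "\<dots> = h * (norm y * (K * norm p))" by simp
    also have "\<dots> \<le> h * (m / 2 * (norm y)\<^sup>2 + K\<^sup>2 / (2 * m) * (norm p)\<^sup>2)"
    proof (intro mult_left_mono)
      \<comment> \<open>Young's inequality, weighted so that the coefficient of
        \<open>(norm y)\<^sup>2\<close> is exactly the \<open>m / 2\<close> from coercivity.\<close>
      have "0 \<le> (m * norm y - K * norm p)\<^sup>2" by simp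
      then show "norm y * (K * norm p) \<le> m / 2 * (norm y)\<^sup>2 + K\<^sup>2 / (2 * m) * (norm p)\<^sup>2"
        using m_pos by (simp add: field_simps power2_eq_square)
    qed (use h in auto)
    finally show ?thesis .
  qed
  moreover have "h * (F + m / 2 * (norm y)\<^sup>2) \<le> h * (g x \<bullet> y)"
    using h gradient_coercive[of x] by (intro mult_left_mono) (auto simp: F_def y_def)
  ultimately show ?thesis unfolding F_def[symmetric] y_def[symmetric] by (simp add: algebra_simps)
qed

end

section \<open>Energy balance along one run of the scheme\<close>

locale ikfad_run = smooth_strongly_convex f "gradient f" m M xstar
  for f :: "real ^ 'n \<Rightarrow> real" and m M xstar +
  fixes \<gamma> \<alpha> \<rho> h :: real and x p \<xi> :: "nat \<Rightarrow> real ^ 'n"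
  assumes gamma_pos: "0 < \<gamma>" and alpha_pos: "0 < \<alpha>" and rho_pos: "0 < \<rho>" and h_pos: "0 < h"
    and iterates: "ikfad_iterates f \<gamma> \<alpha> \<rho> h x p \<xi>"
    and xi0_nonneg: "0 \<le> \<xi> 0 $ i"
    and h_M: "8 * M * h\<^sup>2 \<le> 1" and h_gamma: "2 * M * h \<le> \<gamma>"
begin

text \<open>The damped momentum \<open>\<beta>\<^sub>n p\<^sub>n\<close>.\<close>

definition q :: "nat \<Rightarrow> real ^ 'n" where "q n = (\<chi> i. exp (- (\<gamma> + \<xi> n $ i) * h) * p n $ i)"

definition energy :: "nat \<Rightarrow> real" where
  "energy n = f (x n) - f xstar + ((norm (p n))\<^sup>2 + \<rho> * (norm (\<xi> n))\<^sup>2) / 2"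

text \<open>Squared momentum is damped at rate \<open>2 * \<gamma>\<close>, of which
  \<open>\<gamma>\<close> is reserved for the discretisation error; \<open>2 * \<alpha>\<close> is
  the damping rate of the squared friction variable.\<close>

definition rate :: real where "rate = min \<gamma> (2 * \<alpha>)"

lemma rate_pos: "0 < rate"
  using gamma_pos alpha_pos by (simp add: rate_def)

lemma p_Suc: "p (Suc n) = q n - h *\<^sub>R gradient f (x n)"
  using iterates by (simp add: ikfad_iterates_def q_def vec_eq_iff ikfad_beta_vector_mult)

text \<open>The damped momentum and the gradient in the position update combine to the new momentum,
  so the step is symplectic Euler started from \<open>q n\<close>.\<close>

lemma x_Suc: "x (Suc n) = x n + h *\<^sub>R p (Suc n)"
  using iterates by (simp add: ikfad_iterates_def scaleR_diff_right power2_eq_square)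

lemma xi_Suc: "\<xi> (Suc n) $ i = exp (- \<alpha> * h) *
    sqrt ((\<xi> n $ i)\<^sup>2 + (1 - exp (- 2 * \<xi> n $ i * h)) * (p n $ i)\<^sup>2 / \<rho>)"
proof -
  have "- (2 * h) *\<^sub>R diag (\<xi> n) = diag (\<chi> i. - 2 * \<xi> n $ i * h)"
    by (simp add: diag_def vec_eq_iff)
  then have "mat_exp (- (2 * h) *\<^sub>R diag (\<xi> n)) = diag (\<chi> i. exp (- 2 * \<xi> n $ i * h))"
    by (simp add: mat_exp_diag)
  then show ?thesis
    using iterates
    by (simp add: ikfad_iterates_def vec_sqrt_def vec_square_def diag_vector_mult
        matrix_vector_mult_diff_rdistrib algebra_simps diff_divide_distrib)
qed

lemma xi_nonneg: "0 \<le> \<xi> n $ i"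
proof (induction n)
  case (Suc n)
  then have "exp (- 2 * \<xi> n $ i * h) \<le> 1" using h_pos by simp
  then show ?case unfolding xi_Suc using rho_pos by simp
qed (rule xi0_nonneg)

text \<open>
  The part of \<open>(norm (p n))\<^sup>2\<close> that is not handed over to the friction variable.
  What \<open>p\<close> loses through \<open>\<xi>\<close>, the energy of \<open>\<xi>\<close> gains, so the sum of the two decays.
\<close>

definition retained :: "nat \<Rightarrow> real" where
  "retained n = (\<Sum>i\<in>UNIV. exp (- 2 * \<xi> n $ i * h) * (p n $ i)\<^sup>2)"

lemma retained_nonneg: "0 \<le> retained n"
  by (simp add: retained_def sum_nonneg)

lemma retained_le: "retained n \<le> (norm (p n))\<^sup>2"
  unfolding retained_def norm_vec_squared
  using xi_nonneg h_pos by (intro sum_mono mult_left_le_one_le) auto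

lemma norm_q: "(norm (q n))\<^sup>2 = exp (- 2 * \<gamma> * h) * retained n"
  unfolding retained_def norm_vec_squared
  by (simp add: q_def sum_distrib_left power_mult_distrib algebra_simps flip: exp_add exp_double)

text \<open>Squaring removes the root, whose argument is nonnegative because \<xi> is; the weight
  \<rho> makes the gain equal to the loss of \<open>p\<close>.\<close>

lemma norm_xi_Suc:
  "\<rho> * (norm (\<xi> (Suc n)))\<^sup>2 = exp (- 2 * \<alpha> * h) * (\<rho> * (norm (\<xi> n))\<^sup>2 + (norm (p n))\<^sup>2 - retained n)"
proof -
  have "(\<xi> (Suc n) $ i)\<^sup>2 = exp (- 2 * \<alpha> * h) *
      ((\<xi> n $ i)\<^sup>2 + (1 - exp (- 2 * \<xi> n $ i * h)) * (p n $ i)\<^sup>2 / \<rho>)" for i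
  proof -
    have "exp (- 2 * \<xi> n $ i * h) \<le> 1" using xi_nonneg[of n i] h_pos by simp
    moreover have "(exp (- \<alpha> * h))\<^sup>2 = exp (- 2 * \<alpha> * h)"
      by (simp flip: exp_double)
    ultimately show ?thesis using rho_pos unfolding xi_Suc power_mult_distrib by simp
  qed
  then have comp: "\<rho> * (\<xi> (Suc n) $ i)\<^sup>2 = exp (- 2 * \<alpha> * h) *
      (\<rho> * (\<xi> n $ i)\<^sup>2 + (p n $ i)\<^sup>2 - exp (- 2 * \<xi> n $ i * h) * (p n $ i)\<^sup>2)" for i
    using rho_pos by (simp add: field_simps)
  have "\<rho> * (norm (\<xi> (Suc n)))\<^sup>2 = (\<Sum>i\<in>UNIV. \<rho> * (\<xi> (Suc n) $ i)\<^sup>2)"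
    by (simp add: norm_vec_squared sum_distrib_left)
  also have "\<dots> = exp (- 2 * \<alpha> * h) * (\<Sum>i\<in>UNIV.
      \<rho> * (\<xi> n $ i)\<^sup>2 + (p n $ i)\<^sup>2 - exp (- 2 * \<xi> n $ i * h) * (p n $ i)\<^sup>2)"
    unfolding comp by (rule sum_distrib_left[symmetric])
  finally show ?thesis
    by (simp add: retained_def norm_vec_squared sum.distrib sum_subtractf sum_distrib_left)
qed

text \<open>Both the retained part of the squared momentum and the part handed over to \<xi> shrink
  by at least \<open>exp (- rate * h)\<close>; in their sum \<open>retained n\<close>
  cancels.\<close>

lemma energy_Suc:
  "energy (Suc n) \<le> f (x n) - f xstar + exp (- rate * h) * (((norm (p n))\<^sup>2 + \<rho> * (norm (\<xi> n))\<^sup>2) / 2)"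
proof -
  have "f (x (Suc n)) + (norm (p (Suc n)))\<^sup>2 / 2
      \<le> f (x n) + (1 + 2 * M * h\<^sup>2) * (norm (q n))\<^sup>2 / 2"
    using h_M M_pos by (intro mechanical_energy_step[OF h_pos _ p_Suc x_Suc]) simp
  moreover have "(1 + 2 * M * h\<^sup>2) * (norm (q n))\<^sup>2 \<le> exp (- rate * h) * retained n"
  proof -
    \<comment> \<open>By \<open>h_gamma\<close> the discretisation error costs at most a factor
      \<open>exp (\<gamma> * h)\<close>, half of the exponent in \<open>norm_q\<close>.\<close>
    have "2 * M * h * h \<le> \<gamma> * h" using h_gamma h_pos by (intro mult_right_mono) auto
    then have "1 + 2 * M * h\<^sup>2 \<le> 1 + \<gamma> * h" by (simp add: power2_eq_square mult.assoc)
    also have "\<dots> \<le> exp (\<gamma> * h)" by (rule exp_ge_add_one_self)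
    finally have "1 + 2 * M * h\<^sup>2 \<le> exp (\<gamma> * h)" .
    then have "(1 + 2 * M * h\<^sup>2) * (norm (q n))\<^sup>2 \<le> exp (\<gamma> * h) * (norm (q n))\<^sup>2"
      by (intro mult_right_mono) auto
    also have "\<dots> = exp (- \<gamma> * h) * retained n"
      by (simp add: norm_q mult.assoc[symmetric] flip: exp_add)
    also have "\<dots> \<le> exp (- rate * h) * retained n"
      using h_pos retained_nonneg by (intro mult_right_mono) (auto simp: rate_def)
    finally show ?thesis .
  qed
  moreover have "\<rho> * (norm (\<xi> (Suc n)))\<^sup>2
      \<le> exp (- rate * h) * (\<rho> * (norm (\<xi> n))\<^sup>2 + (norm (p n))\<^sup>2 - retained n)"
    unfolding norm_xi_Suc
  proof (intro mult_right_mono)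
    have "0 \<le> \<rho> * (norm (\<xi> n))\<^sup>2" using rho_pos by simp
    then show "0 \<le> \<rho> * (norm (\<xi> n))\<^sup>2 + (norm (p n))\<^sup>2 - retained n"
      using retained_le[of n] by linarith
  qed (use h_pos in \<open>auto simp: rate_def\<close>)
  moreover have "exp (- rate * h) * (\<rho> * (norm (\<xi> n))\<^sup>2 + (norm (p n))\<^sup>2 - retained n)
      = 2 * (exp (- rate * h) * (((norm (p n))\<^sup>2 + \<rho> * (norm (\<xi> n))\<^sup>2) / 2))
        - exp (- rate * h) * retained n"
    by (simp add: algebra_simps)
  ultimately show ?thesis unfolding energy_def by argo
qed

lemma energy_le_initial: "energy n \<le> energy 0"
proof (induction n)
  case (Suc n)
  have "exp (- rate * h) * (((norm (p n))\<^sup>2 + \<rho> * (norm (\<xi> n))\<^sup>2) / 2)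
      \<le> ((norm (p n))\<^sup>2 + \<rho> * (norm (\<xi> n))\<^sup>2) / 2"
    using rate_pos h_pos rho_pos by (intro mult_left_le_one_le) auto
  then have "energy (Suc n) \<le> energy n" using energy_Suc[of n] unfolding energy_def by linarith
  then show ?case using Suc by simp
qed simp

lemma energy_nonneg: "0 \<le> energy n"
  using minimum[of "x n"] rho_pos by (simp add: energy_def)

lemma norm_xi_le: "norm (\<xi> n) \<le> sqrt (2 * energy 0 / \<rho>)"
proof (rule real_le_rsqrt)
  have "\<rho> * (norm (\<xi> n))\<^sup>2 \<le> 2 * energy 0"
    using energy_le_initial[of n] minimum[of "x n"] zero_le_power2[of "norm (p n)"]
    unfolding energy_def by argo
  then show "(norm (\<xi> n))\<^sup>2 \<le> 2 * energy 0 / \<rho>" using rho_pos by (simp add: field_simps)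
qed

lemma norm_q_le: "norm (q n) \<le> norm (p n)"
proof (rule power2_le_imp_le)
  have "(norm (q n))\<^sup>2 \<le> retained n"
    unfolding norm_q using gamma_pos h_pos retained_nonneg by (intro mult_left_le_one_le) auto
  then show "(norm (q n))\<^sup>2 \<le> (norm (p n))\<^sup>2" using retained_le[of n] by linarith
qed simp

text \<open>Componentwise \<open>1 - exp (- s) \<le> s\<close>; this supplies
  \<open>K = \<gamma> + \<Xi>\<close> for \<open>cross_term_step\<close>.\<close>

lemma norm_p_minus_q_le:
  assumes "norm (\<xi> n) \<le> \<Xi>"
  shows "norm (p n - q n) \<le> (\<gamma> + \<Xi>) * h * norm (p n)"
proof -
  have K: "0 \<le> (\<gamma> + \<Xi>) * h" 
    using order_trans[OF norm_ge_zero assms] gamma_pos h_pos by simp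
  have "\<bar>(p n - q n) $ i\<bar> \<le> \<bar>(((\<gamma> + \<Xi>) * h) *\<^sub>R p n) $ i\<bar>" for i
  proof -
    have xi: "\<xi> n $ i \<le> \<Xi>" using component_le_norm_cart[of "\<xi> n" i] assms by linarith
    have "1 - (\<gamma> + \<xi> n $ i) * h \<le> exp (- (\<gamma> + \<xi> n $ i) * h)"
      using exp_ge_add_one_self[of "- (\<gamma> + \<xi> n $ i) * h"] by linarith
    moreover have "(\<gamma> + \<xi> n $ i) * h \<le> (\<gamma> + \<Xi>) * h"
      using xi h_pos by (intro mult_right_mono) auto
    moreover have "exp (- (\<gamma> + \<xi> n $ i) * h) \<le> 1"
      using gamma_pos xi_nonneg[of n i] h_pos by (simp add: mult_nonpos_nonneg)
    ultimately have "\<bar>1 - exp (- (\<gamma> + \<xi> n $ i) * h)\<bar> \<le> (\<gamma> + \<Xi>) * h" by linarith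
    then have "\<bar>1 - exp (- (\<gamma> + \<xi> n $ i) * h)\<bar> * \<bar>p n $ i\<bar> \<le> (\<gamma> + \<Xi>) * h * \<bar>p n $ i\<bar>"
      by (intro mult_right_mono) auto
    moreover have "(p n - q n) $ i = (1 - exp (- (\<gamma> + \<xi> n $ i) * h)) * p n $ i"
      by (simp add: q_def algebra_simps)
    moreover have "\<bar>(((\<gamma> + \<Xi>) * h) *\<^sub>R p n) $ i\<bar> = (\<gamma> + \<Xi>) * h * \<bar>p n $ i\<bar>"
      using K by (metis abs_mult abs_of_nonneg real_scaleR_def vector_scaleR_component)
    ultimately show ?thesis by (simp only: abs_mult)
  qed
  then have "norm (p n - q n) \<le> norm (((\<gamma> + \<Xi>) * h) *\<^sub>R p n)"
    by (intro norm_le_componentwise_cart) simp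
  then show ?thesis using K by (simp only: norm_scaleR abs_of_nonneg)
qed

section \<open>Exponential decay of the modified energy\<close>

text \<open>The parameter \<Xi> stands for any upper bound on the friction variable, so that
  \<epsilon> and \<kappa> can be fixed before the trajectory is known.\<close>

lemma energy_decay:
  fixes \<Xi> \<epsilon> :: real
  assumes h_rate: "rate * h \<le> 1"
    and Xi: "sqrt (2 * energy 0 / \<rho>) \<le> \<Xi>"
    and eps: "0 < \<epsilon>" "\<epsilon> \<le> 1 / 2" "\<epsilon> \<le> m / 2" "\<epsilon> * (2 + (\<gamma> + \<Xi>)\<^sup>2 / (2 * m)) \<le> rate / 8"
    and kappa: "0 < \<kappa>" "\<kappa> \<le> rate / 6" "\<kappa> \<le> \<epsilon> / 3"
  shows "energy n \<le> 3 * energy 0 * exp (- \<kappa> * real n * h)"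
proof -
  define W where "W n = energy n + \<epsilon> * (p n \<bullet> (x n - xstar))" for n
  \<comment> \<open>Quadratic growth and the first bounds on \<epsilon> keep \<open>W\<close>
    between \<open>1 / 2\<close> and \<open>3 / 2\<close> of the energy; the ratio is the factor 3
    of the claim.\<close>
  have close: "\<bar>\<epsilon> * (p n \<bullet> (x n - xstar))\<bar> \<le> energy n / 2" for n
  proof -
    have "2 * \<bar>p n \<bullet> (x n - xstar)\<bar> \<le> (norm (p n))\<^sup>2 + (norm (x n - xstar))\<^sup>2"
      using Cauchy_Schwarz_ineq2[of "p n" "x n - xstar"]
        sum_squares_bound[of "norm (p n)" "norm (x n - xstar)"] by linarith
    then have "\<epsilon> * (2 * \<bar>p n \<bullet> (x n - xstar)\<bar>) \<le> \<epsilon> * ((norm (p n))\<^sup>2 + (norm (x n - xstar))\<^sup>2)"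
      using eps by (intro mult_left_mono) auto
    then have "2 * \<bar>\<epsilon> * (p n \<bullet> (x n - xstar))\<bar>
        \<le> \<epsilon> * (norm (p n))\<^sup>2 + \<epsilon> * (norm (x n - xstar))\<^sup>2"
      using eps by (simp add: abs_mult distrib_left)
    moreover have "\<epsilon> * (norm (p n))\<^sup>2 \<le> 1 / 2 * (norm (p n))\<^sup>2"
      using eps by (intro mult_right_mono) auto
    moreover have "\<epsilon> * (norm (x n - xstar))\<^sup>2 \<le> m / 2 * (norm (x n - xstar))\<^sup>2"
      using eps by (intro mult_right_mono) auto
    moreover have "0 \<le> \<rho> * (norm (\<xi> n))\<^sup>2" using rho_pos by simp
    ultimately show ?thesis
      using quadratic_growth[of "x n"] unfolding energy_def by argo
  qed
  have W_Suc: "W (Suc n) \<le> exp (- \<kappa> * h) * W n" for n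
  proof -
    define F where "F = f (x n) - f xstar"
    define P where "P = (norm (p n))\<^sup>2"
    define R where "R = \<rho> * (norm (\<xi> n))\<^sup>2"
    define A where "A = 2 + (\<gamma> + \<Xi>)\<^sup>2 / (2 * m)"
    have nn: "0 \<le> F" "0 \<le> P" "0 \<le> R"
      using minimum[of "x n"] rho_pos by (auto simp: F_def P_def R_def)
    have "p (Suc n) \<bullet> (x (Suc n) - xstar) \<le> p n \<bullet> (x n - xstar) + h * (A * P - F / 2)"
      unfolding A_def P_def F_def
      using order_trans[OF norm_xi_le Xi]
      by (intro cross_term_step[OF h_pos h_M p_Suc x_Suc norm_q_le] norm_p_minus_q_le)
    then have "\<epsilon> * (p (Suc n) \<bullet> (x (Suc n) - xstar))
        \<le> \<epsilon> * (p n \<bullet> (x n - xstar) + h * (A * P - F / 2))"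
      using eps by (intro mult_left_mono) auto
    moreover have "energy (Suc n) \<le> F + exp (- rate * h) * ((P + R) / 2)"
      using energy_Suc[of n] by (simp add: F_def P_def R_def)
    moreover have "exp (- rate * h) * ((P + R) / 2) \<le> (1 - rate * h / 2) * ((P + R) / 2)"
      using exp_minus_le_linear[of "rate * h"] h_rate rate_pos h_pos nn
      by (intro mult_right_mono) auto
    moreover have energy: "energy n = F + (P + R) / 2" by (simp add: energy_def F_def P_def R_def)
    ultimately have "W (Suc n) \<le> F + (1 - rate * h / 2) * ((P + R) / 2)
        + \<epsilon> * (p n \<bullet> (x n - xstar) + h * (A * P - F / 2))"
      unfolding W_def by argo
    also have "\<dots> = W n + h * (\<epsilon> * A * P - \<epsilon> * F / 2 - rate * (P + R) / 4)"
      by (simp add: W_def energy field_simps)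
    also have "h * (\<epsilon> * A * P - \<epsilon> * F / 2 - rate * (P + R) / 4) \<le> h * (- \<kappa> * W n)"
    proof (intro mult_left_mono)
      \<comment> \<open>The cross term uses up at most half of the dissipation
        \<open>rate * P / 4\<close>. The rest must cover \<open>3 / 4 * \<kappa> * P\<close>, whence
        \<open>\<kappa> \<le> rate / 6\<close>; likewise \<open>\<epsilon> * F / 2\<close> must
        cover \<open>3 / 2 * \<kappa> * F\<close>, whence
        \<open>\<kappa> \<le> \<epsilon> / 3\<close>.\<close>
      have "W n \<le> 3 / 2 * (F + (P + R) / 2)"
        using abs_le_D1[OF close[of n]] energy unfolding W_def by argo
      then have "\<kappa> * W n \<le> \<kappa> * (3 / 2 * (F + (P + R) / 2))"
        using kappa by (intro mult_left_mono) auto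
      moreover have "\<epsilon> * A * P \<le> rate / 8 * P"
        using eps nn by (intro mult_right_mono) (auto simp: A_def)
      moreover have "\<kappa> * F \<le> \<epsilon> / 3 * F" "\<kappa> * P \<le> rate / 6 * P" "\<kappa> * R \<le> rate / 6 * R"
        using kappa nn by (simp_all only: mult_right_mono)
      moreover have "\<kappa> * (3 / 2 * (F + (P + R) / 2)) = 3 / 2 * (\<kappa> * F) + 3 / 4 * (\<kappa> * P) + 3 / 4 * (\<kappa> * R)"
        by (simp add: field_simps)
      moreover have "rate * (P + R) / 4 = rate * P / 4 + rate * R / 4" by (simp add: field_simps)
      moreover have "0 \<le> rate * R" using rate_pos nn by simp
      ultimately show "\<epsilon> * A * P - \<epsilon> * F / 2 - rate * (P + R) / 4 \<le> - \<kappa> * W n"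
        by argo
    qed (use h_pos in auto)
    also have "W n + h * (- \<kappa> * W n) = (1 + - \<kappa> * h) * W n" by (simp add: algebra_simps)
    also have "\<dots> \<le> exp (- \<kappa> * h) * W n"
      using close[of n] energy_nonneg[of n]
      by (intro mult_right_mono exp_ge_add_one_self) (auto simp: W_def abs_le_iff)
    finally show ?thesis by simp
  qed
  have "W n \<le> exp (- \<kappa> * real n * h) * W 0"
  proof (induction n)
    case (Suc n)
    have "W (Suc n) \<le> exp (- \<kappa> * h) * (exp (- \<kappa> * real n * h) * W 0)"
      using W_Suc[of n] Suc by (meson exp_ge_zero mult_left_mono order_trans)
    then show ?case by (simp add: algebra_simps flip: exp_add)
  qed simp
  also have "\<dots> \<le> exp (- \<kappa> * real n * h) * (3 / 2 * energy 0)"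
    using close[of 0] by (intro mult_left_mono) (auto simp: W_def abs_le_iff)
  finally show ?thesis using abs_le_D2[OF close[of n]] unfolding W_def by argo
qed

end

section \<open>Constants uniform over the initial data\<close>

theorem theorem2:
  fixes f :: "real ^ 'n \<Rightarrow> real" and m M \<gamma> \<alpha> \<rho> L :: real and xstar :: "real ^ 'n"
  assumes "C2 f"
    and "0 < m" and "m \<le> M"
    and "\<And>x \<mu>. eigenvalue (hessian f x) \<mu> \<Longrightarrow> m \<le> \<mu> \<and> \<mu> \<le> M"
    and "\<And>y. f xstar \<le> f y"
    and "\<And>z. (\<And>y. f z \<le> f y) \<Longrightarrow> z = xstar"
    and "\<gamma> > 0" and "\<alpha> > 0" and "\<rho> > 0" and "L > 0"
  shows "\<exists>\<delta>tstar > 0. \<exists>\<kappa> > 0. \<exists>C > 0.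
    \<forall>(x0 :: real ^ 'n) (p0 :: real ^ 'n) (\<xi>0 :: real ^ 'n).
      (\<forall>i. 0 \<le> \<xi>0 $ i) \<longrightarrow> norm x0 + norm p0 + norm \<xi>0 \<le> L \<longrightarrow>
      (\<forall>\<delta>t. 0 < \<delta>t \<longrightarrow> \<delta>t < \<delta>tstar \<longrightarrow>
        (\<forall>x p \<xi>. x 0 = x0 \<longrightarrow> p 0 = p0 \<longrightarrow> \<xi> 0 = \<xi>0 \<longrightarrow>
          ikfad_iterates f \<gamma> \<alpha> \<rho> \<delta>t x p \<xi> \<longrightarrow>
          (\<forall>n. f (x n) - f xstar + (norm (p n))\<^sup>2 + (norm (\<xi> n))\<^sup>2
               \<le> C * exp (- \<kappa> * real n * \<delta>t))))"
proof -
  interpret smooth_strongly_convex f "gradient f" m M xstar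
    using assms(2,3,5) hessian_quadratic_bounds[OF assms(1,4)] by unfold_locales auto
  \<comment> \<open>\<open>B\<close> bounds the initial energy of every admissible start, so \<Xi>
    and all constants built from it depend on \<open>L\<close> but not on the trajectory.\<close>
  define B where "B = M / 2 * (L + norm xstar)\<^sup>2 + (L\<^sup>2 + \<rho> * L\<^sup>2) / 2"
  define \<Xi> where "\<Xi> = sqrt (2 * B / \<rho>)"
  define A where "A = 2 + (\<gamma> + \<Xi>)\<^sup>2 / (2 * m)"
  define c where "c = min \<gamma> (2 * \<alpha>)"
  define \<epsilon> where "\<epsilon> = min (min (1 / 2) (m / 2)) (c / (8 * A))"
  define \<kappa> where "\<kappa> = min (c / 6) (\<epsilon> / 3)"
  \<comment> \<open>The first two entries give \<open>8 * M * h\<^sup>2 \<le> 1\<close>, the third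
    \<open>h_gamma\<close>, and the last \<open>rate * h \<le> 1\<close>.\<close>
  define \<delta> where "\<delta> = min (min 1 (1 / (8 * M))) (min (\<gamma> / (2 * M)) (1 / c))"
  \<comment> \<open>\<open>3 * B\<close> comes from the decay of the energy; 3 and
    \<open>2 / \<rho>\<close> compare the energy with the unweighted quantities of the
    claim.\<close>
  define C where "C = (3 + 2 / \<rho>) * (3 * B)"
  have c: "0 < c" using assms by (simp add: c_def)
  have A: "0 < A" using m_pos by (simp add: A_def add_pos_nonneg)
  have \<epsilon>: "0 < \<epsilon>" "\<epsilon> \<le> 1 / 2" "\<epsilon> \<le> m / 2" using A c m_pos by (auto simp: \<epsilon>_def)
  have "\<epsilon> \<le> c / (8 * A)" by (simp add: \<epsilon>_def)
  then have \<epsilon>A: "\<epsilon> * A \<le> c / 8" using A by (simp add: field_simps)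
  have \<kappa>: "0 < \<kappa>" "\<kappa> \<le> c / 6" "\<kappa> \<le> \<epsilon> / 3" using c \<epsilon> by (auto simp: \<kappa>_def)
  have \<delta>: "0 < \<delta>" using assms c M_pos by (simp add: \<delta>_def)
  have B: "0 < B"
  proof -
    have "0 \<le> M / 2 * (L + norm xstar)\<^sup>2" using M_pos by simp
    moreover have "0 < L\<^sup>2 + \<rho> * L\<^sup>2" using \<open>L > 0\<close> \<open>\<rho> > 0\<close> by (simp add: add_pos_pos)
    ultimately show ?thesis unfolding B_def by argo
  qed
  have C: "0 < C" using B \<open>\<rho> > 0\<close> by (simp add: C_def add_pos_pos)
  have bound: "f (x n) - f xstar + (norm (p n))\<^sup>2 + (norm (\<xi> n))\<^sup>2 \<le> C * exp (- \<kappa> * real n * h)"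
    if nonneg: "\<forall>i. 0 \<le> \<xi> 0 $ i" and init: "norm (x 0) + norm (p 0) + norm (\<xi> 0) \<le> L"
      and h: "0 < h" "h < \<delta>" and it: "ikfad_iterates f \<gamma> \<alpha> \<rho> h x p \<xi>"
    for h n and x p \<xi> :: "nat \<Rightarrow> real ^ 'n"
  proof -
    have h': "h \<le> 1" "8 * M * h \<le> 1" "2 * M * h \<le> \<gamma>" "c * h \<le> 1"
      using h c M_pos by (auto simp: \<delta>_def field_simps)
    have "8 * M * h * h \<le> 1 * 1" using h h' M_pos by (intro mult_mono) auto
    then interpret run: ikfad_run f m M xstar \<gamma> \<alpha> \<rho> h x p \<xi>
      using assms nonneg h h' it by unfold_locales (auto simp: power2_eq_square mult.assoc)
    have rate: "run.rate = c" by (simp add: run.rate_def c_def)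
    have E0: "run.energy 0 \<le> B"
    proof -
      have n: "norm (x 0) \<le> L" "norm (p 0) \<le> L" "norm (\<xi> 0) \<le> L"
        using init norm_ge_zero[of "x 0"] norm_ge_zero[of "p 0"] norm_ge_zero[of "\<xi> 0"] by linarith+
      have "f (x 0) - f xstar \<le> M / 2 * (norm (x 0 - xstar))\<^sup>2" by (rule quadratic_upper)
      also have "\<dots> \<le> M / 2 * (L + norm xstar)\<^sup>2"
        using n M_pos norm_triangle_ineq4[of "x 0" xstar] by (intro mult_left_mono power_mono) auto
      finally have "f (x 0) - f xstar \<le> M / 2 * (L + norm xstar)\<^sup>2" .
      moreover have "(norm (p 0))\<^sup>2 \<le> L\<^sup>2" using n by (intro power_mono) auto
      moreover have "\<rho> * (norm (\<xi> 0))\<^sup>2 \<le> \<rho> * L\<^sup>2"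
        using n \<open>\<rho> > 0\<close> by (intro mult_left_mono power_mono) auto
      ultimately show ?thesis unfolding run.energy_def B_def by argo
    qed
    have "run.energy n \<le> 3 * run.energy 0 * exp (- \<kappa> * real n * h)"
    proof (rule run.energy_decay)
      show "sqrt (2 * run.energy 0 / \<rho>) \<le> \<Xi>"
        using E0 \<open>\<rho> > 0\<close> unfolding \<Xi>_def by (intro real_sqrt_le_mono divide_right_mono) auto
    qed (use \<epsilon> \<epsilon>A \<kappa> h' in \<open>auto simp: rate A_def\<close>)
    also have "\<dots> \<le> 3 * B * exp (- \<kappa> * real n * h)" using E0 by simp
    finally have E: "run.energy n \<le> 3 * B * exp (- \<kappa> * real n * h)" .
    have "f (x n) - f xstar + (norm (p n))\<^sup>2 + (norm (\<xi> n))\<^sup>2 \<le> (3 + 2 / \<rho>) * run.energy n"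
    proof -
      have F: "0 \<le> f (x n) - f xstar" using minimum by simp
      have R: "0 \<le> \<rho> * (norm (\<xi> n))\<^sup>2" using \<open>\<rho> > 0\<close> by simp
      have "\<rho> * (norm (\<xi> n))\<^sup>2 \<le> 2 * run.energy n"
        using F zero_le_power2[of "norm (p n)"] unfolding run.energy_def by argo
      then have "(norm (\<xi> n))\<^sup>2 \<le> 2 / \<rho> * run.energy n"
        using \<open>\<rho> > 0\<close> by (simp add: field_simps)
      moreover have "f (x n) - f xstar + (norm (p n))\<^sup>2 \<le> 3 * run.energy n"
        using F R zero_le_power2[of "norm (p n)"] unfolding run.energy_def by argo
      ultimately show ?thesis by (simp add: distrib_right)
    qed
    also have "\<dots> \<le> (3 + 2 / \<rho>) * (3 * B * exp (- \<kappa> * real n * h))"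
      using E \<open>\<rho> > 0\<close> by (intro mult_left_mono) auto
    also have "\<dots> = C * exp (- \<kappa> * real n * h)" by (simp add: C_def)
    finally show ?thesis .
  qed
  show ?thesis
  proof (rule exI[of _ \<delta>], rule conjI[OF \<delta>], rule exI[of _ \<kappa>], rule conjI[OF \<kappa>(1)],
      rule exI[of _ C], rule conjI[OF C], intro allI impI)
    fix x0 p0 \<xi>0 :: "real ^ 'n" and h and x p \<xi> :: "nat \<Rightarrow> real ^ 'n" and n
    assume "\<forall>i. 0 \<le> \<xi>0 $ i" "norm x0 + norm p0 + norm \<xi>0 \<le> L" "0 < h" "h < \<delta>"
      and "x 0 = x0" "p 0 = p0" "\<xi> 0 = \<xi>0" and "ikfad_iterates f \<gamma> \<alpha> \<rho> h x p \<xi>"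
    then show "f (x n) - f xstar + (norm (p n))\<^sup>2 + (norm (\<xi> n))\<^sup>2 \<le> C * exp (- \<kappa> * real n * h)"
      by (intro bound) auto
  qed
qed

end
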